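(* Let $m$ and $r$ be integers with $m \ge r \ge 3$. Let $G$ be an $r$-regular graph of even order with $\lambda_c(G) \ge mr - m + 1$, and let $M$ be a distance $3$ matching in $G$ with $|M| = m$. If there exist $mr - \left\lceil \frac{r}{2} \right\rceil + 1$ edge-disjoint odd ears of $V(M)$ in $G$, then $M$ extends to a perfect matching of $G$.
   Context: All graphs are finite and simple. $V(M)$ is the set of endvertices of the edges of $M$. A set $F$ of edges of a graph $G$ is a cyclic edge cut if $G-F$ has two components each of which contains a cycle. The cyclic edge-connectivity $\lambda_c(G)$ is the size of a minimum cyclic edge cut of $G$; if $G$ has no cyclic edge cut, $\lambda_c(G)=\infty$. The distance between two edges $e,f$ is the length of a shortest path joining an endvertex of $e$ and an endvertex of $f$. A matching $M$ is a distance $d$ matching if the distance between each pair of distinct edges of $M$ is at least $d$. For $U \subseteq V(G)$, an ear of $U$ is either a path having both endvertices but no internal vertices in $U$, or a cycle having exactly one vertex in $U$ (in particular, every edge joining two vertices of $U$ is an ear of $U$). An ear is odd if it contains an odd number of edges. A matching $M$ of $G$ extends to a perfect matching if there is a perfect matching $M^*$ of $G$ with $M \subseteq M^*$. *)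

theory Defs
  imports Complex_Main "HOL-Library.Extended_Nat"
begin

text \<open>
  A finite simple graph is given by its vertex set \<open>V\<close> and its edge set \<open>E\<close>, whose members
  are two-element subsets of \<open>V\<close>.
\<close>

definition simple_graph :: "'a set \<Rightarrow> 'a set set \<Rightarrow> bool" where
  "simple_graph V E \<longleftrightarrow> finite V \<and> (\<forall>e\<in>E. e \<subseteq> V \<and> card e = 2)"

definition degree :: "'a set set \<Rightarrow> 'a \<Rightarrow> nat" where
  "degree E v = card {e \<in> E. v \<in> e}"

definition regular :: "nat \<Rightarrow> 'a set \<Rightarrow> 'a set set \<Rightarrow> bool" where
  "regular r V E \<longleftrightarrow> (\<forall>v\<in>V. degree E v = r)"

text \<open>
  Paths and cycles are lists of consecutive vertices. A cycle is written as a closed list, in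
  which the first vertex is repeated at the end, so that \<open>walk_edges\<close> gives the edge set in
  both cases.
\<close>

fun walk_edges :: "'a list \<Rightarrow> 'a set set" where
  "walk_edges (u # v # vs) = insert {u, v} (walk_edges (v # vs))"
| "walk_edges _ = {}"

definition is_path :: "'a set \<Rightarrow> 'a set set \<Rightarrow> 'a list \<Rightarrow> bool" where
  "is_path V E p \<longleftrightarrow> p \<noteq> [] \<and> distinct p \<and> set p \<subseteq> V \<and> walk_edges p \<subseteq> E"

definition is_cycle :: "'a set \<Rightarrow> 'a set set \<Rightarrow> 'a list \<Rightarrow> bool" where
  "is_cycle V E c \<longleftrightarrow>
     length c \<ge> 4 \<and> hd c = last c \<and> distinct (tl c) \<and> set c \<subseteq> V \<and> walk_edges c \<subseteq> E"

definition components :: "'a set \<Rightarrow> 'a set set \<Rightarrow> 'a set set" where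
  "components V E =
     {{v. \<exists>p. is_path V E p \<and> hd p = u \<and> last p = v} | u. u \<in> V}"

definition cyclic_edge_cut :: "'a set \<Rightarrow> 'a set set \<Rightarrow> 'a set set \<Rightarrow> bool" where
  "cyclic_edge_cut V E F \<longleftrightarrow> F \<subseteq> E \<and>
     (\<exists>C \<in> components V (E - F). \<exists>D \<in> components V (E - F). C \<noteq> D \<and>
        (\<exists>c. is_cycle V (E - F) c \<and> set c \<subseteq> C) \<and>
        (\<exists>d. is_cycle V (E - F) d \<and> set d \<subseteq> D))"

text \<open>
  In \<open>enat\<close> the infimum of the empty set is \<open>\<infinity>\<close>, and that of a nonempty set is its minimum.
\<close>

definition cyclic_edge_connectivity :: "'a set \<Rightarrow> 'a set set \<Rightarrow> enat" where
  "cyclic_edge_connectivity V E = Inf {enat (card F) | F. cyclic_edge_cut V E F}"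

definition edge_distance :: "'a set \<Rightarrow> 'a set set \<Rightarrow> 'a set \<Rightarrow> 'a set \<Rightarrow> enat" where
  "edge_distance V E e f =
     Inf {enat (card (walk_edges p)) | p. is_path V E p \<and> hd p \<in> e \<and> last p \<in> f}"

definition matching :: "'a set set \<Rightarrow> 'a set set \<Rightarrow> bool" where
  "matching E M \<longleftrightarrow> M \<subseteq> E \<and> pairwise disjnt M"

definition distance_matching :: "nat \<Rightarrow> 'a set \<Rightarrow> 'a set set \<Rightarrow> 'a set set \<Rightarrow> bool" where
  "distance_matching d V E M \<longleftrightarrow>
     matching E M \<and> pairwise (\<lambda>e f. edge_distance V E e f \<ge> enat d) M"

definition perfect_matching :: "'a set \<Rightarrow> 'a set set \<Rightarrow> 'a set set \<Rightarrow> bool" where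
  "perfect_matching V E M \<longleftrightarrow> matching E M \<and> \<Union>M = V"

definition extends_to_perfect_matching :: "'a set \<Rightarrow> 'a set set \<Rightarrow> 'a set set \<Rightarrow> bool" where
  "extends_to_perfect_matching V E M \<longleftrightarrow> (\<exists>N. perfect_matching V E N \<and> M \<subseteq> N)"

text \<open>
  One-vertex paths are not excluded from the first disjunct; having no edges, they are never
  odd ears.
\<close>

definition ear :: "'a set \<Rightarrow> 'a set set \<Rightarrow> 'a set \<Rightarrow> 'a list \<Rightarrow> bool" where
  "ear V E U p \<longleftrightarrow>
     is_path V E p \<and> hd p \<in> U \<and> last p \<in> U \<and> (set p - {hd p, last p}) \<inter> U = {} \<or>
     is_cycle V E p \<and> card (set p \<inter> U) = 1"

definition odd_ear :: "'a set \<Rightarrow> 'a set set \<Rightarrow> 'a set \<Rightarrow> 'a list \<Rightarrow> bool" where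
  "odd_ear V E U p \<longleftrightarrow> ear V E U p \<and> odd (card (walk_edges p))"

text \<open>
  Two different lists describing the same path or cycle have the same edges, so a family of
  pairwise edge-disjoint odd ears contains at most one of them.
\<close>

definition edge_disjoint :: "'a list set \<Rightarrow> bool" where
  "edge_disjoint P \<longleftrightarrow> pairwise (\<lambda>p q. disjnt (walk_edges p) (walk_edges q)) P"

end

theory Submission
  imports Defs
begin

text \<open>
  Put \<open>U = V(M)\<close> and suppose that \<open>G - U\<close> has no perfect matching. By Tutte's theorem there are
  \<open>S \<subseteq> V - U\<close> and a partition of \<open>V - U - S\<close> into at least \<open>|S| + 2\<close> odd parts with no edges
  between them. If the number of parts is chosen maximal, then each part is a single vertex or
  contains a cycle, because a vertex with at most one neighbour in its part could be split off.

  Two parts with cycles would each be left by at least \<open>mr - m + 1\<close> edges, more than the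
  \<open>S \<union> U\<close> side can supply. So all parts but one, \<open>C\<close>, are single vertices. An odd ear of \<open>U\<close> that
  has no edge inside \<open>X = S \<union> U\<close> and avoids \<open>C\<close> would alternate between \<open>X\<close> and the single
  vertices; hence every odd ear has an edge inside \<open>X\<close> or uses at least two edges leaving \<open>C\<close>.
  Counting degrees in \<open>X\<close>, edge-disjointness bounds the number of odd ears by \<open>mr - r/2\<close>.
\<close>

subsection \<open>Tutte's theorem\<close>

text \<open>Induction on \<open>card I\<close>. If some nonempty proper \<open>J\<close> is tight,
  \<open>J\<close> and \<open>I - J\<close> are matched separately. Otherwise every nonempty proper
  subfamily has slack at least one, so one index can be matched to any of its elements and
  removed.\<close>

lemma hall_marriage:
  fixes A :: "'i \<Rightarrow> 'b set"
  assumes "finite I" and "\<And>i. i \<in> I \<Longrightarrow> finite (A i)"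
    and "\<And>J. J \<subseteq> I \<Longrightarrow> card J \<le> card (\<Union>(A ` J))"
  shows "\<exists>f. inj_on f I \<and> (\<forall>i\<in>I. f i \<in> A i)"
  using assms
proof (induction "card I" arbitrary: I A rule: less_induct)
  case less
  note fin = less.prems(1) and finA = less.prems(2) and hc = less.prems(3)
  show ?case
  proof (cases "I = {}")
    case True
    then show ?thesis by simp
  next
    case False
    then obtain i where i: "i \<in> I" by blast
    show ?thesis
    proof (cases "\<exists>J. J \<subset> I \<and> J \<noteq> {} \<and> card (\<Union>(A ` J)) \<le> card J")
      case True
      then obtain J where J: "J \<subset> I" "J \<noteq> {}" "card (\<Union>(A ` J)) \<le> card J" by blast
      have finJ: "finite J" and finK: "finite (I - J)" using J fin by (auto intro: finite_subset)
      let ?T = "\<Union>(A ` J)"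
      have finT: "finite ?T" using J finA finJ by auto
      have "\<exists>f. inj_on f J \<and> (\<forall>i\<in>J. f i \<in> A i)"
        using J fin by (intro less.hyps finJ psubset_card_mono) (auto intro!: finA hc)
      then obtain f where f: "inj_on f J" "\<forall>i\<in>J. f i \<in> A i" by blast
      \<comment> \<open>Hall's condition survives the removal of \<open>?T\<close>: apply it to
        \<open>J \<union> K\<close> and subtract \<open>card ?T \<le> card J\<close>.\<close>
      have "card K \<le> card (\<Union>((\<lambda>i. A i - ?T) ` K))" if K: "K \<subseteq> I - J" for K
      proof -
        have "finite K" using K finK finite_subset by blast
        have "finite (\<Union>(A ` K))" using K finA \<open>finite K\<close> by auto
        have "card J + card K = card (J \<union> K)"
          using K finJ \<open>finite K\<close> by (intro card_Un_disjoint[symmetric]) auto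
        also have "\<dots> \<le> card (\<Union>(A ` (J \<union> K)))" using K J by (intro hc) auto
        also have "\<Union>(A ` (J \<union> K)) = ?T \<union> \<Union>((\<lambda>i. A i - ?T) ` K)" by auto
        also have "card \<dots> \<le> card ?T + card (\<Union>((\<lambda>i. A i - ?T) ` K))" by (rule card_Un_le)
        finally show ?thesis using J(3) by linarith
      qed
      moreover have "card (I - J) < card I" using J fin by (intro psubset_card_mono) auto
      ultimately have "\<exists>g. inj_on g (I - J) \<and> (\<forall>i\<in>I - J. g i \<in> A i - ?T)"
        by (intro less.hyps finK) (auto simp: finA)
      then obtain g where g: "inj_on g (I - J)" "\<forall>i\<in>I - J. g i \<in> A i - ?T" by blast
      let ?h = "\<lambda>i. if i \<in> J then f i else g i"
      have "inj_on ?h I"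
      proof (rule inj_onI)
        have sep: "f a \<noteq> g b" if "a \<in> J" "b \<in> I - J" for a b
        proof -
          have "f a \<in> A a" "g b \<notin> ?T" using f(2) g(2) that by simp_all
          then show ?thesis using that(1) by auto
        qed
        fix a b assume "a \<in> I" "b \<in> I" "?h a = ?h b"
        then show "a = b"
          using sep[of a b] sep[of b a] inj_onD[OF f(1), of a b] inj_onD[OF g(1), of a b]
          by (cases "a \<in> J"; cases "b \<in> J") auto
      qed
      moreover have "\<forall>i\<in>I. ?h i \<in> A i" using f g by auto
      ultimately show ?thesis by blast
    next
      case False
      have "card {i} \<le> card (\<Union>(A ` {i}))" using i by (intro hc) auto
      then obtain x where x: "x \<in> A i" using finA[OF i] by fastforce
      \<comment> \<open>Without tight proper subfamilies, losing the single element \<open>x\<close>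
        costs no more than the slack.\<close>
      have "card K \<le> card (\<Union>((\<lambda>j. A j - {x}) ` K))" if K: "K \<subseteq> I - {i}" for K
      proof (cases "K = {}")
        case False
        have "K \<subset> I" using K i by auto
        then have "card K < card (\<Union>(A ` K))"
          using False \<open>\<not> (\<exists>J. J \<subset> I \<and> J \<noteq> {} \<and> card (\<Union>(A ` J)) \<le> card J)\<close> not_less by blast
        moreover have "\<Union>((\<lambda>j. A j - {x}) ` K) = \<Union>(A ` K) - {x}" by auto
        ultimately show ?thesis by (simp add: card_Diff_singleton_if) linarith
      qed simp
      moreover have "card (I - {i}) < card I" using i fin by (intro psubset_card_mono) auto
      ultimately have "\<exists>g. inj_on g (I - {i}) \<and> (\<forall>j\<in>I - {i}. g j \<in> A j - {x})"
        using fin by (intro less.hyps) (auto simp: finA)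
      then obtain g where g: "inj_on g (I - {i})" "\<forall>j\<in>I - {i}. g j \<in> A j - {x}" by blast
      have "inj_on (g(i := x)) I" using g unfolding inj_on_def by auto
      moreover have "\<forall>j\<in>I. (g(i := x)) j \<in> A j" using g x by auto
      ultimately show ?thesis by blast
    qed
  qed
qed

section \<open>Separated sets and odd barriers\<close>

text \<open>Disjointness is included so that a pairwise separated family is at once a family of
  disjoint parts and one without edges between different parts.\<close>

definition separated :: "'a set set \<Rightarrow> 'a set \<Rightarrow> 'a set \<Rightarrow> bool" where
  "separated E A B \<longleftrightarrow> disjnt A B \<and> (\<forall>e\<in>E. disjnt e A \<or> disjnt e B)"

lemma separated_sym: "separated E A B \<longleftrightarrow> separated E B A"
  by (auto simp: separated_def disjnt_sym)

lemma separated_subset: "separated E A B \<Longrightarrow> A' \<subseteq> A \<Longrightarrow> separated E A' B"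
  unfolding separated_def by (meson disjnt_subset1 disjnt_subset2)

lemma separated_Un: "separated E (A \<union> A') B \<longleftrightarrow> separated E A B \<and> separated E A' B"
  by (auto simp: separated_def)

lemma separated_disjoint: "separated E A B \<Longrightarrow> A \<inter> B = {}"
  by (simp add: separated_def disjnt_def)

lemma pairwise_separated_insert:
  "pairwise (separated E) (insert A \<C>) \<longleftrightarrow>
     pairwise (separated E) \<C> \<and> (\<forall>B\<in>\<C> - {A}. separated E A B)"
  unfolding pairwise_insert using separated_sym by blast

text \<open>
  The parts of a barrier need not be connected, so even components of \<open>W - S\<close> may be absorbed
  into odd parts.
\<close>
definition odd_barrier :: "'a set set \<Rightarrow> 'a set \<Rightarrow> 'a set \<Rightarrow> 'a set set \<Rightarrow> bool" where
  "odd_barrier E W S \<C> \<longleftrightarrow> S \<subseteq> W \<and> \<Union>\<C> = W - S \<and> (\<forall>A\<in>\<C>. odd (card A)) \<and>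
     pairwise (separated E) \<C>"

lemma odd_barrier_finite:
  assumes "odd_barrier E W S \<C>" "finite W"
  shows "finite S" "finite \<C>" "A \<in> \<C> \<Longrightarrow> finite A"
proof -
  show "finite S" using assms finite_subset by (auto simp: odd_barrier_def)
  have "finite (\<Union>\<C>)" using assms by (auto simp: odd_barrier_def)
  then show "finite \<C>" by (rule finite_UnionD)
  show "finite A" if "A \<in> \<C>" using \<open>finite (\<Union>\<C>)\<close> that by (meson Union_upper finite_subset)
qed

lemma odd_barrier_card:
  assumes "odd_barrier E W S \<C>" "finite W"
  shows "card W = card S + (\<Sum>A\<in>\<C>. card A)"
proof -
  note fin = odd_barrier_finite[OF assms]
  have "card (\<Union>\<C>) = (\<Sum>A\<in>\<C>. card A)"
    using assms fin(3) by (intro card_Union_disjoint) (auto simp: odd_barrier_def pairwise_def separated_def)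
  moreover have "card W = card S + card (W - S)"
    using assms fin(1) by (simp add: odd_barrier_def card_Diff_subset card_mono)
  ultimately show ?thesis using assms by (simp add: odd_barrier_def)
qed

text \<open>Modulo 2 the odd parts sum to their number. For even \<open>card W\<close> this turns a
  surplus \<open>card S < card \<C>\<close> into a surplus of at least two.\<close>

lemma odd_barrier_parity:
  assumes "odd_barrier E W S \<C>" "finite W"
  shows "even (card W) \<longleftrightarrow> (even (card S) \<longleftrightarrow> even (card \<C>))"
proof -
  have "{A \<in> \<C>. odd (card A)} = \<C>" using assms by (auto simp: odd_barrier_def)
  then have "even (\<Sum>A\<in>\<C>. card A) \<longleftrightarrow> even (card \<C>)"
    using odd_barrier_finite[OF assms] by (simp add: even_sum_iff)
  then show ?thesis using odd_barrier_card[OF assms] by auto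
qed

text \<open>A barrier of a single part can replace that part, since its pieces inherit separation
  from the other parts. This drives both maximality arguments: one in Tutte's theorem, one for
  splitting off a vertex of small degree.\<close>

lemma odd_barrier_refine:
  assumes "finite W" and b: "odd_barrier E W S \<C>" and A: "A \<in> \<C>" and d: "odd_barrier E A T \<D>"
  shows "odd_barrier E W (S \<union> T) (\<C> - {A} \<union> \<D>)"
    "card (S \<union> T) = card S + card T" "card (\<C> - {A} \<union> \<D>) + 1 = card \<C> + card \<D>"
proof -
  note fin = odd_barrier_finite[OF b \<open>finite W\<close>]
  note finA = fin(3)[OF A]
  note fin' = odd_barrier_finite[OF d finA]
  have AW: "A \<subseteq> W - S" using b A by (auto simp: odd_barrier_def)
  have sub: "D \<subseteq> A" "D \<noteq> {}" if "D \<in> \<D>" for D using d that by (auto simp: odd_barrier_def)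
  have disj: "separated E A B" if "B \<in> \<C> - {A}" for B
    using that b A by (auto simp: odd_barrier_def pairwise_def)
  have disj': "separated E D B" if "B \<in> \<C> - {A}" "D \<in> \<D>" for B D
    using disj[OF that(1)] sub[OF that(2)] separated_subset by blast
  have "\<Union>(\<C> - {A}) = W - S - A"
    using b A separated_disjoint[OF disj] unfolding odd_barrier_def by blast
  then have un: "\<Union>(\<C> - {A} \<union> \<D>) = W - (S \<union> T)"
    using d AW unfolding odd_barrier_def by auto
  have pw: "pairwise (separated E) (\<C> - {A} \<union> \<D>)"
  proof (rule pairwiseI)
    fix D B assume DB: "D \<in> \<C> - {A} \<union> \<D>" "B \<in> \<C> - {A} \<union> \<D>" "D \<noteq> B"
    have "pairwise (separated E) \<C>" "pairwise (separated E) \<D>"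
      using b d by (simp_all add: odd_barrier_def)
    then show "separated E D B"
      using DB disj'[of B D] disj'[of D B] separated_sym[of E D B] by (auto dest: pairwiseD)
  qed
  show "odd_barrier E W (S \<union> T) (\<C> - {A} \<union> \<D>)"
    using un pw b d AW unfolding odd_barrier_def by auto
  have "S \<inter> T = {}" using AW d by (auto simp: odd_barrier_def)
  then show "card (S \<union> T) = card S + card T" using fin(1) fin'(1) by (intro card_Un_disjoint)
  \<comment> \<open>Odd pieces are nonempty subsets of \<open>A\<close>, so none of them can
    coincide with a part disjoint from \<open>A\<close>.\<close>
  have "(\<C> - {A}) \<inter> \<D> = {}"
  proof (intro equals0I, elim IntE)
    fix D assume "D \<in> \<C> - {A}" "D \<in> \<D>"
    then show False using separated_disjoint[OF disj] sub[of D] by fastforce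
  qed
  then have "card (\<C> - {A} \<union> \<D>) = card (\<C> - {A}) + card \<D>"
    using fin(2) fin'(2) by (intro card_Un_disjoint) auto
  moreover have "card \<C> > 0" using fin(2) A card_gt_0_iff by blast
  ultimately show "card (\<C> - {A} \<union> \<D>) + 1 = card \<C> + card \<D>" using A by simp
qed

text \<open>
  Among the barriers with \<open>|\<C>| = |S|\<close> one with \<open>|S|\<close> maximal is taken. Maximality and the
  induction hypothesis match \<open>A - {c}\<close> perfectly for all \<open>c \<in> A \<in> \<C>\<close>, and Hall's theorem matches
  \<open>\<C>\<close> to \<open>S\<close>.
\<close>
lemma tutte:
  assumes "finite W" and "even (card W)" and "\<And>e. e \<in> E \<Longrightarrow> card e = 2"
    and "\<And>S \<C>. odd_barrier E W S \<C> \<Longrightarrow> card \<C> \<le> card S"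
  shows "\<exists>N. perfect_matching W E N"
  using assms(1,2,4)
proof (induction "card W" arbitrary: W rule: less_induct)
  case less
  note finW = less.prems(1) and evenW = less.prems(2) and le = less.prems(3)
  show ?case
  proof (cases "W = {}")
    case True
    then show ?thesis by (auto simp: perfect_matching_def matching_def intro: exI[of _ "{}"])
  next
    case False
    then obtain w where w: "w \<in> W" by blast
    define good where "good k \<longleftrightarrow> (\<exists>S \<C>. odd_barrier E W S \<C> \<and> card \<C> = card S \<and> card S = k)" for k
    \<comment> \<open>Deleting any one vertex leaves a single odd part, so barriers with equality
      exist.\<close>
    have "odd (card (W - {w}))" using w evenW finW False by (simp add: card_gt_0_iff)
    then have "odd_barrier E W {w} {W - {w}}" using w by (auto simp: odd_barrier_def)
    then have "good 1" unfolding good_def by (intro exI[of _ "{w}"] exI[of _ "{W - {w}}"]) simp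
    moreover have "\<forall>k. good k \<longrightarrow> k \<le> card W"
      using finW by (auto simp: good_def odd_barrier_def intro!: card_mono)
    ultimately obtain k where "good k" and kmax: "\<And>j. good j \<Longrightarrow> j \<le> k"
      by (metis Nat.ex_has_greatest_nat)
    then obtain S \<C> where b: "odd_barrier E W S \<C>" and eq: "card \<C> = card S" "card S = k"
      unfolding good_def by blast
    note fin = odd_barrier_finite[OF b finW]
    have crit: "\<exists>N. perfect_matching (A - {c}) E N" if A: "A \<in> \<C>" and c: "c \<in> A" for A c
    proof (rule less.hyps)
      have AW: "A \<subseteq> W" using b A by (auto simp: odd_barrier_def)
      then have "A - {c} \<subset> W" using c by auto
      then show "card (A - {c}) < card W" using finW by (rule psubset_card_mono[rotated])
      show "finite (A - {c})" using fin(3)[OF A] by simp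
      show ev: "even (card (A - {c}))" using b A c fin(3)[OF A] by (auto simp: odd_barrier_def)
      fix T \<D> assume d: "odd_barrier E (A - {c}) T \<D>"
      show "card \<D> \<le> card T"
      proof (rule ccontr)
        assume "\<not> card \<D> \<le> card T"
        moreover have "even (card T) \<longleftrightarrow> even (card \<D>)"
          using odd_barrier_parity[OF d] ev fin(3)[OF A] by simp
        ultimately have ge: "card \<D> \<ge> card T + 2" by presburger
        \<comment> \<open>Putting \<open>c\<close> back as a deleted vertex gives a barrier of
          \<open>A\<close>. The refined barrier deletes \<open>card S + card T + 1\<close> vertices
          and has at least that many parts; equality follows from \<open>le\<close>, against the
          choice of \<open>k\<close>.\<close>
        have d': "odd_barrier E A (insert c T) \<D>" using d c by (auto simp: odd_barrier_def)
        have "card (insert c T) = card T + 1"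
          using d odd_barrier_finite(1)[OF d] fin(3)[OF A]
          by (subst card_insert_disjoint) (auto simp: odd_barrier_def)
        note r = odd_barrier_refine[OF finW b A d', unfolded this]
        have "card (\<C> - {A} \<union> \<D>) = card (S \<union> insert c T)"
          using r(2,3) le[OF r(1)] ge eq by linarith
        then have "good (card (S \<union> insert c T))"
          unfolding good_def using r(1) by blast
        from kmax[OF this] show False using r(2) eq by simp
      qed
    qed
    define nb where "nb A = {s \<in> S. \<exists>c\<in>A. {s, c} \<in> E}" for A
    have "\<exists>f. inj_on f \<C> \<and> (\<forall>A\<in>\<C>. f A \<in> nb A)"
    proof (rule hall_marriage)
      show "finite \<C>" by fact
      show "finite (nb A)" for A unfolding nb_def using fin(1) by simp
      fix \<D> assume \<D>: "\<D> \<subseteq> \<C>"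
      show "card \<D> \<le> card (\<Union>(nb ` \<D>))"
      proof (rule ccontr)
        assume gt: "\<not> card \<D> \<le> card (\<Union>(nb ` \<D>))"
        then have "\<D> \<noteq> {}" by auto
        then obtain D where D: "D \<in> \<D>" by blast
        let ?T = "\<Union>(nb ` \<D>)"
        \<comment> \<open>A violation of Hall's condition makes \<open>?T\<close> a deleted set with
          more than \<open>card ?T\<close> parts. The leftover \<open>R\<close> has no edges to
          these parts; it is absorbed into \<open>D\<close> if even and becomes a further part if
          odd.\<close>
        define R where "R = W - ?T - \<Union>\<D>"
        have TS: "?T \<subseteq> S" by (auto simp: nb_def)
        have finR: "finite R" "finite D" "finite \<D>"
          using finW fin \<D> D by (auto simp: R_def intro: finite_subset)
        have subW: "S \<subseteq> W" "\<Union>\<D> \<subseteq> W - S" using b \<D> by (auto simp: odd_barrier_def)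
        have RD: "separated E R A" if A: "A \<in> \<D>" for A
          unfolding separated_def
        proof (intro conjI ballI)
          show "disjnt R A" using A by (auto simp: R_def disjnt_def)
          fix e assume e: "e \<in> E"
          show "disjnt e R \<or> disjnt e A"
          proof (rule ccontr)
            assume "\<not> ?thesis"
            then obtain x y where xy: "x \<in> e" "x \<in> R" "y \<in> e" "y \<in> A" by (auto simp: disjnt_def)
            then have "x \<noteq> y" using \<open>disjnt R A\<close> by (auto simp: disjnt_def)
            then have exy: "e = {x, y}" using xy assms(3)[OF e] by (auto simp: card_2_iff)
            show False
            proof (cases "x \<in> S")
              case True
              then have "x \<in> nb A" using exy e xy by (auto simp: nb_def)
              then show False using A xy by (auto simp: R_def)
            next
              case False
              then have "x \<in> \<Union>\<C>" using xy b by (auto simp: R_def odd_barrier_def)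
              then obtain B where B: "B \<in> \<C>" "x \<in> B" by blast
              have "B \<noteq> A" using B A xy by (auto simp: R_def)
              then have "disjnt e A \<or> disjnt e B"
                using b B A \<D> e unfolding odd_barrier_def pairwise_def separated_def by blast
              then show False using xy B by (auto simp: disjnt_def)
            qed
          qed
        qed
        have pD: "pairwise (separated E) \<D>"
          using b \<D> by (auto simp: odd_barrier_def intro: pairwise_subset)
        have oD: "\<forall>A\<in>\<D>. odd (card A)" using b \<D> by (auto simp: odd_barrier_def)
        have unT: "\<Union>\<D> \<union> R = W - ?T" using subW TS by (auto simp: R_def)
        show False
        proof (cases "even (card R)")
          case True
          let ?\<D> = "insert (D \<union> R) (\<D> - {D})"
          have "odd (card (D \<union> R))"
            using True oD D finR RD[OF D] by (subst card_Un_disjoint) (auto dest: separated_disjoint)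
          moreover have "\<Union>?\<D> = W - ?T" using unT D by auto
          moreover have "pairwise (separated E) ?\<D>"
            using pD RD D unfolding pairwise_separated_insert
            by (auto simp: pairwise_def separated_Un)
          ultimately have "odd_barrier E W ?T ?\<D>"
            using oD subW TS by (auto simp: odd_barrier_def)
          from le[OF this] have "card ?\<D> \<le> card ?T" .
          \<comment> \<open>Rules out that the enlarged part collides with an old one, which would
            lower the number of parts.\<close>
          moreover have "D \<union> R \<notin> \<D> - {D}"
          proof
            assume DR: "D \<union> R \<in> \<D> - {D}"
            then have "separated E D (D \<union> R)" using pD D unfolding pairwise_def by (metis DiffE insertI1)
            from separated_disjoint[OF this] show False using oD D by fastforce
          qed
          then have "card ?\<D> = card \<D>" using D finR by (simp add: card_Suc_Diff1 del: card_Diff_insert)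
          ultimately show False using gt by simp
        next
          case False
          have "pairwise (separated E) (insert R \<D>)"
            using pD RD unfolding pairwise_separated_insert by auto
          then have "odd_barrier E W ?T (insert R \<D>)"
            using False oD subW TS unT by (auto simp: odd_barrier_def)
          from le[OF this] have "card (insert R \<D>) \<le> card ?T" .
          then show False using gt card_insert_le[of \<D> R] by linarith
        qed
      qed
    qed
    then obtain f where f: "inj_on f \<C>" "\<And>A. A \<in> \<C> \<Longrightarrow> f A \<in> nb A" by blast
    have fS: "f ` \<C> = S"
    proof (rule card_subset_eq)
      show "f ` \<C> \<subseteq> S" using f(2) by (auto simp: nb_def)
    qed (use fin f eq in \<open>auto simp: card_image\<close>)
    \<comment> \<open>The edge from \<open>f A\<close> to some \<open>c\<close> in \<open>A\<close>
      is completed by a perfect matching of \<open>A - {c}\<close>.\<close>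
    have "\<exists>N. N \<subseteq> E \<and> pairwise disjnt N \<and> \<Union>N = insert (f A) A" if A: "A \<in> \<C>" for A
    proof -
      obtain c where c: "c \<in> A" "{f A, c} \<in> E" using f(2)[OF A] by (auto simp: nb_def)
      obtain N where N: "perfect_matching (A - {c}) E N" using crit[OF A c(1)] by blast
      have "f A \<notin> A" using f(2)[OF A] b A by (auto simp: nb_def odd_barrier_def)
      then have "pairwise disjnt (insert {f A, c} N)"
        using N unfolding pairwise_insert perfect_matching_def matching_def by (auto simp: disjnt_def)
      then show ?thesis using N c
        by (intro exI[of _ "insert {f A, c} N"]) (auto simp: perfect_matching_def matching_def)
    qed
    then obtain N where N: "\<And>A. A \<in> \<C> \<Longrightarrow> N A \<subseteq> E \<and> pairwise disjnt (N A) \<and> \<Union>(N A) = insert (f A) A"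
      by metis
    let ?N = "\<Union>(N ` \<C>)"
    have "pairwise disjnt ?N"
    proof (rule pairwiseI)
      fix x y assume "x \<in> ?N" "y \<in> ?N" "x \<noteq> y"
      then obtain A B where AB: "A \<in> \<C>" "B \<in> \<C>" "x \<in> N A" "y \<in> N B" by blast
      show "disjnt x y"
      proof (cases "A = B")
        case True
        then show ?thesis using N[OF AB(1)] AB \<open>x \<noteq> y\<close> by (auto simp: pairwise_def)
      next
        case False
        then have "disjnt A B" using b AB unfolding odd_barrier_def pairwise_def separated_def by blast
        moreover have "f A \<noteq> f B" using f(1) AB False by (auto dest: inj_onD)
        moreover have "f A \<in> S" "f B \<in> S" "S \<inter> A = {}" "S \<inter> B = {}"
          using fS AB b by (auto simp: odd_barrier_def)
        ultimately have "disjnt (insert (f A) A) (insert (f B) B)" by (auto simp: disjnt_def)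
        moreover have "x \<subseteq> insert (f A) A" "y \<subseteq> insert (f B) B" using N AB by blast+
        ultimately show ?thesis by (meson disjnt_subset1 disjnt_subset2)
      qed
    qed
    moreover have "\<Union>?N = (\<Union>A\<in>\<C>. \<Union>(N A))" by blast
    then have "\<Union>?N = f ` \<C> \<union> \<Union>\<C>" using N by auto
    then have "\<Union>?N = W" using fS b by (auto simp: odd_barrier_def)
    moreover have "?N \<subseteq> E" using N by blast
    ultimately show ?thesis unfolding perfect_matching_def matching_def by blast
  qed
qed

subsection \<open>Edge boundaries, cycles and ears\<close>

lemma walk_edges_subset: "e \<in> walk_edges p \<Longrightarrow> e \<subseteq> set p"
  by (induction p rule: walk_edges.induct) auto

lemma finite_walk_edges: "finite (walk_edges p)"
  by (induction p rule: walk_edges.induct) auto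

lemma walk_edges_append:
  "xs \<noteq> [] \<Longrightarrow> ys \<noteq> [] \<Longrightarrow>
    walk_edges (xs @ ys) = insert {last xs, hd ys} (walk_edges xs \<union> walk_edges ys)"
proof (induction xs rule: walk_edges.induct)
  case ("2_2" v)
  then show ?case by (cases ys) auto
qed auto

text \<open>In a longest path all neighbours of the first vertex lie on the path. Two of them exist,
  and the one that is not the second vertex closes a cycle.\<close>

lemma min_degree_imp_cycle:
  assumes "finite A" "A \<noteq> {}" "\<And>e. e \<in> E \<Longrightarrow> card e = 2"
    and "\<And>x. x \<in> A \<Longrightarrow> \<exists>y\<in>A. \<exists>z\<in>A. y \<noteq> z \<and> {x, y} \<in> E \<and> {x, z} \<in> E"
  shows "\<exists>c. is_cycle A E c"
proof -
  define good where "good k \<longleftrightarrow> (\<exists>p. is_path A E p \<and> length p = k)" for k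
  obtain a where "a \<in> A" using assms(2) by blast
  then have "is_path A E [a]" by (simp add: is_path_def)
  then have "good 1" unfolding good_def by force
  moreover have "\<forall>k. good k \<longrightarrow> k \<le> card A"
    using assms(1) by (auto simp: good_def is_path_def distinct_card[symmetric] intro: card_mono)
  ultimately obtain k where "good k" and kmax: "\<And>j. good j \<Longrightarrow> j \<le> k"
    by (metis Nat.ex_has_greatest_nat)
  then obtain p where p: "is_path A E p" "length p = k" unfolding good_def by blast
  then obtain x ps where xps: "p = x # ps" by (cases p) (auto simp: is_path_def)
  then obtain y z where yz: "y \<in> A" "z \<in> A" "y \<noteq> z" "{x, y} \<in> E" "{x, z} \<in> E"
    using assms(4)[of x] p by (auto simp: is_path_def)
  have mem: "w \<in> set ps" if "w \<in> A" "{x, w} \<in> E" for w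
  proof (rule ccontr)
    assume "w \<notin> set ps"
    moreover have "w \<noteq> x" using assms(3)[OF that(2)] by auto
    ultimately have "is_path A E (w # p)"
      using p that xps by (auto simp: is_path_def insert_commute)
    then have "good (length (w # p))" unfolding good_def by blast
    from kmax[OF this] show False using p by simp
  qed
  obtain w where w: "w \<in> A" "{x, w} \<in> E" "w \<noteq> hd ps" using yz by metis
  from split_list[OF mem[OF w(1,2)]] obtain as bs where ps: "ps = as @ w # bs" by blast
  then have "as \<noteq> []" using w(3) by auto
  have "walk_edges (x # as @ [w]) \<subseteq> walk_edges (x # ps)"
    using walk_edges_append[of "x # as @ [w]" bs] ps by (cases "bs = []") auto
  then have "walk_edges ((x # as @ [w]) @ [x]) \<subseteq> E"
    using p xps w(2) by (subst walk_edges_append) (auto simp: is_path_def insert_commute)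
  then have "is_cycle A E (x # as @ [w, x])"
    using p xps ps w \<open>as \<noteq> []\<close> by (cases as) (auto simp: is_cycle_def is_path_def)
  then show ?thesis by blast
qed

section \<open>Edge boundaries, degree sums and cyclic cuts\<close>

definition inner_edges :: "'a set set \<Rightarrow> 'a set \<Rightarrow> 'a set set" where
  "inner_edges E A = {e \<in> E. e \<subseteq> A}"

text \<open>For two-element edges this is the usual cut of edges leaving \<open>A\<close>.\<close>

definition edge_boundary :: "'a set set \<Rightarrow> 'a set \<Rightarrow> 'a set set" where
  "edge_boundary E A = {e \<in> E. card (e \<inter> A) = 1}"

lemma simple_graph_finite: "simple_graph V E \<Longrightarrow> finite V \<and> finite E"
  unfolding simple_graph_def by (meson Pow_iff finite_Pow_iff finite_subset subsetI)

lemma pair_in_edge_boundary_iff: "u \<noteq> v \<Longrightarrow> {u, v} \<in> edge_boundary E A \<longleftrightarrow> {u, v} \<in> E \<and> (u \<in> A \<longleftrightarrow> v \<notin> A)"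
  by (auto simp: edge_boundary_def Int_insert_left)

text \<open>Double counting of incidences: an edge contributes \<open>card (e \<inter> A)\<close>,
  which is 2 for inner edges, 1 for boundary edges and 0 otherwise.\<close>

lemma sum_degree:
  assumes "simple_graph V E" "A \<subseteq> V"
  shows "(\<Sum>v\<in>A. degree E v) = 2 * card (inner_edges E A) + card (edge_boundary E A)"
proof -
  have fin: "finite E" "finite A" using assms simple_graph_finite finite_subset by blast+
  have "(\<Sum>v\<in>A. degree E v) = (\<Sum>v\<in>A. \<Sum>e\<in>E. of_bool (v \<in> e))"
    using fin by (simp add: degree_def of_bool_def sum.If_cases Int_def)
  also have "\<dots> = (\<Sum>e\<in>E. \<Sum>v\<in>A. of_bool (v \<in> e))" by (rule sum.swap)
  also have "\<dots> = (\<Sum>e\<in>E. card (e \<inter> A))"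
    using fin by (intro sum.cong) (simp_all add: of_bool_def sum.If_cases Int_commute)
  also have "\<dots> = (\<Sum>e\<in>E. 2 * of_bool (e \<subseteq> A) + of_bool (card (e \<inter> A) = 1))"
  proof (rule sum.cong)
    fix e assume "e \<in> E"
    then obtain u v where "e = {u, v}" "u \<noteq> v" using assms by (auto simp: simple_graph_def card_2_iff)
    then show "card (e \<inter> A) = 2 * of_bool (e \<subseteq> A) + of_bool (card (e \<inter> A) = 1)"
      by (auto simp: Int_insert_left)
  qed simp
  also have "\<dots> = 2 * card (inner_edges E A) + card (edge_boundary E A)"
    using fin by (simp add: sum.distrib sum_distrib_left[symmetric] inner_edges_def edge_boundary_def of_bool_def sum.If_cases Int_def)
  finally show ?thesis .
qed

lemma walk_stays:
  assumes "walk_edges p \<inter> edge_boundary E A = {}" "walk_edges p \<subseteq> E"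
  shows "set p \<subseteq> A \<or> set p \<inter> A = {}"
  using assms
proof (induction p rule: walk_edges.induct)
  case (1 u v vs)
  then have "u \<in> A \<longleftrightarrow> v \<in> A" using pair_in_edge_boundary_iff[of u v E A] by (cases "u = v") auto
  then show ?case using 1 by auto
qed auto

text \<open>The closed list without its repeated last vertex is distinct, so each of its prefixes is
  a path from \<open>hd c\<close>.\<close>

lemma cycle_subset_component:
  assumes "is_cycle V E c"
  shows "set c \<subseteq> {v. \<exists>p. is_path V E p \<and> hd p = hd c \<and> last p = v}"
proof
  fix v assume v: "v \<in> set c"
  obtain u q where c: "c = u # q" "q \<noteq> []"
    using assms by (cases c; cases "tl c") (auto simp: is_cycle_def)
  obtain q' where q: "q = q' @ [u]" using assms c by (metis append_butlast_last_id is_cycle_def last_ConsR list.sel(1))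
  have "v \<in> set (u # q')" using v c q by auto
  then obtain xs ys where s: "u # q' = xs @ v # ys" by (meson split_list)
  then have c': "c = (xs @ [v]) @ (ys @ [u])" using c q by simp
  have "walk_edges (xs @ [v]) \<subseteq> walk_edges c" unfolding c' by (subst walk_edges_append) auto
  moreover have "distinct (u # q')" using assms c q by (auto simp: is_cycle_def)
  then have "distinct (xs @ [v])" using s by (metis append.assoc append_Cons append_Nil distinct_append)
  ultimately have "is_path V E (xs @ [v])"
    using assms c' by (auto simp: is_path_def is_cycle_def)
  moreover have "hd (xs @ [v]) = hd c" using s c by (cases xs) auto
  ultimately show "v \<in> {v. \<exists>p. is_path V E p \<and> hd p = hd c \<and> last p = v}"
    by (intro CollectI exI[of _ "xs @ [v]"]) simp
qed

text \<open>Both cycles survive the deletion, since their edges stay on one side. A path avoiding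
  the boundary cannot leave \<open>A\<close>, so the components of the two cycles differ.\<close>

lemma cut_is_cyclic_edge_cut:
  assumes "simple_graph V E" "A \<subseteq> V" "is_cycle A E c" "is_cycle (V - A) E d"
  shows "cyclic_edge_cut V E (edge_boundary E A)"
proof -
  let ?E = "E - edge_boundary E A"
  let ?C = "\<lambda>u. {v. \<exists>p. is_path V ?E p \<and> hd p = u \<and> last p = v}"
  have card2: "e \<in> E \<Longrightarrow> card e = 2" for e using assms(1) by (simp add: simple_graph_def)
  have "e \<notin> edge_boundary E A" if e: "e \<in> E" "e \<subseteq> A \<or> e \<subseteq> V - A" for e
  proof -
    have "e \<inter> A = e \<or> e \<inter> A = {}" using e by blast
    then show ?thesis using card2[OF e(1)] by (auto simp: edge_boundary_def)
  qed
  then have "walk_edges q \<subseteq> ?E" if "walk_edges q \<subseteq> E" "set q \<subseteq> A \<or> set q \<subseteq> V - A" for q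
    using that walk_edges_subset[of _ q] by (meson DiffI subset_eq subset_trans)
  then have cyc: "is_cycle V ?E c" "is_cycle V ?E d"
    using assms(2-4) by (auto simp: is_cycle_def)
  have ne: "hd c \<in> A" "hd d \<in> V - A"
    using assms(3,4) unfolding is_cycle_def
    by (metis hd_in_set list.size(3) not_numeral_le_zero subsetD)+
  have comp: "?C (hd c) \<in> components V ?E" "?C (hd d) \<in> components V ?E"
    using ne assms(2) unfolding components_def by blast+
  have diff: "?C (hd c) \<noteq> ?C (hd d)"
  proof -
    have "?C (hd c) \<subseteq> A"
    proof
      fix v assume "v \<in> ?C (hd c)"
      then obtain p where p: "is_path V ?E p" "hd p = hd c" "last p = v" by blast
      then have "set p \<subseteq> A \<or> set p \<inter> A = {}"
        by (intro walk_stays[of p E]) (auto simp: is_path_def)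
      moreover have "hd c \<in> set p" "v \<in> set p"
        using p by (metis hd_in_set is_path_def, metis last_in_set is_path_def)
      ultimately show "v \<in> A" using ne(1) by blast
    qed
    moreover have "is_path V ?E [hd d]" using ne by (simp add: is_path_def)
    then have "hd d \<in> ?C (hd d)" by force
    ultimately show ?thesis using ne by blast
  qed
  have "set c \<subseteq> ?C (hd c)" "set d \<subseteq> ?C (hd d)"
    using cyc by (simp_all only: cycle_subset_component)
  with cyc have "\<exists>c. is_cycle V ?E c \<and> set c \<subseteq> ?C (hd c')" if "c' \<in> {c, d}" for c'
    using that by blast
  then show ?thesis
    unfolding cyclic_edge_cut_def
    by (intro conjI bexI[OF _ comp(1)] bexI[OF _ comp(2)] diff) (auto simp: edge_boundary_def)
qed

section \<open>Parity of ears across a boundary\<close>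

text \<open>Each boundary edge switches sides, and distinct vertices ensure that no edge of the path
  is counted twice.\<close>

lemma path_cut_parity:
  assumes "distinct p" "p \<noteq> []" "walk_edges p \<subseteq> E"
  shows "odd (card (walk_edges p \<inter> edge_boundary E A)) \<longleftrightarrow> (hd p \<in> A) \<noteq> (last p \<in> A)"
  using assms
proof (induction p rule: walk_edges.induct)
  case (1 u v vs)
  have "{u, v} \<notin> walk_edges (v # vs)"
    using 1(2) walk_edges_subset[of "{u, v}" "v # vs"] by auto
  then have "card (walk_edges (u # v # vs) \<inter> edge_boundary E A) =
      card (walk_edges (v # vs) \<inter> edge_boundary E A) + of_bool ({u, v} \<in> edge_boundary E A)"
    by (simp add: Int_insert_left finite_walk_edges)
  moreover have "{u, v} \<in> edge_boundary E A \<longleftrightarrow> (u \<in> A) \<noteq> (v \<in> A)"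
    using 1(2,4) by (subst pair_in_edge_boundary_iff) auto
  ultimately show ?case using 1 by auto
qed auto

text \<open>Removing the first edge leaves a path from \<open>v\<close> back to \<open>u\<close>;
  its parity and that of \<open>{u, v}\<close> agree.\<close>

lemma cycle_cut_parity:
  assumes "is_cycle V E c"
  shows "even (card (walk_edges c \<inter> edge_boundary E A))"
proof -
  obtain u v w q where c: "c = u # v # w # q" "q \<noteq> []"
    using assms by (auto simp: is_cycle_def numeral_eq_Suc Suc_le_length_iff)
  let ?p = "v # w # q"
  have d: "distinct ?p" and l: "last q = u" and E: "walk_edges c \<subseteq> E"
    using assms c by (auto simp: is_cycle_def)
  have u: "u \<in> set q" using l c by auto
  \<comment> \<open>Here it matters that a cycle has at least three vertices: \<open>w\<close> lies
    strictly between \<open>v\<close> and the final \<open>u\<close>.\<close>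
  then have "{u, v} \<notin> walk_edges ?p"
    using d walk_edges_subset[of "{u, v}" "w # q"] by (auto simp: doubleton_eq_iff)
  then have "card (walk_edges c \<inter> edge_boundary E A) =
      card (walk_edges ?p \<inter> edge_boundary E A) + of_bool ({u, v} \<in> edge_boundary E A)"
    using c by (simp add: Int_insert_left finite_walk_edges del: walk_edges.simps(1)) (simp add: Int_insert_left finite_walk_edges)
  moreover have "{u, v} \<in> edge_boundary E A \<longleftrightarrow> (u \<in> A) \<noteq> (v \<in> A)"
    using d u E c by (subst pair_in_edge_boundary_iff) auto
  moreover have "odd (card (walk_edges ?p \<inter> edge_boundary E A)) \<longleftrightarrow> (v \<in> A) \<noteq> (u \<in> A)"
    using path_cut_parity[OF d] E c l by auto
  ultimately show ?thesis by auto
qed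

lemma ear_cut_parity:
  assumes "ear V E U p" "U \<subseteq> A \<or> U \<inter> A = {}"
  shows "even (card (walk_edges p \<inter> edge_boundary E A))"
  using assms(1) unfolding ear_def
proof
  assume "is_path V E p \<and> hd p \<in> U \<and> last p \<in> U \<and> (set p - {hd p, last p}) \<inter> U = {}"
  moreover from this have "hd p \<in> A \<longleftrightarrow> last p \<in> A" using assms(2) by blast
  ultimately show ?thesis using path_cut_parity[of p E A] by (auto simp: is_path_def)
qed (use cycle_cut_parity in blast)

text \<open>An ear of smaller weight never enters \<open>C\<close> and has no edge inside
  \<open>X\<close>. All its edges then cross the boundary of \<open>X\<close>, so by parity their
  number is even.\<close>

lemma odd_ear_weight:
  assumes "odd_ear V E U p" "U \<subseteq> X" "X \<inter> C = {}" "{} \<notin> E"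
    and cover: "\<And>e. e \<in> E \<Longrightarrow> e \<subseteq> X \<or> e \<subseteq> C \<or> e \<in> edge_boundary E X"
  shows "2 \<le> 2 * card (walk_edges p \<inter> inner_edges E X) + card (walk_edges p \<inter> edge_boundary E C)"
proof (rule ccontr)
  assume lt: "\<not> ?thesis"
  have ear: "ear V E U p" and "odd (card (walk_edges p))" using assms(1) by (auto simp: odd_ear_def)
  have wE: "walk_edges p \<subseteq> E" using ear by (auto simp: ear_def is_path_def is_cycle_def)
  have "even (card (walk_edges p \<inter> edge_boundary E C))" using ear assms(2,3) by (intro ear_cut_parity) auto
  \<comment> \<open>A weight below 2 allows at most one boundary edge of \<open>C\<close>, and
    evenness excludes exactly one.\<close>
  then have "card (walk_edges p \<inter> inner_edges E X) = 0" "card (walk_edges p \<inter> edge_boundary E C) = 0"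
    using lt by presburger+
  then have no: "walk_edges p \<inter> inner_edges E X = {}" "walk_edges p \<inter> edge_boundary E C = {}"
    by (simp_all add: finite_walk_edges)
  have "set p \<inter> U \<noteq> {}"
    using ear unfolding ear_def is_path_def
    by (metis card.empty disjoint_iff hd_in_set zero_neq_one)
  then have "set p \<inter> C = {}" using walk_stays[OF no(2) wE] assms(2,3) by blast
  have "walk_edges p \<subseteq> edge_boundary E X"
  proof
    fix e assume e: "e \<in> walk_edges p"
    then have "e \<in> E" "\<not> e \<subseteq> X" using wE no(1) by (auto simp: inner_edges_def)
    moreover have "\<not> e \<subseteq> C"
      using walk_edges_subset[OF e] \<open>set p \<inter> C = {}\<close> \<open>e \<in> E\<close> assms(4) by (cases "e = {}") auto
    ultimately show "e \<in> edge_boundary E X" using cover by blast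
  qed
  then have "walk_edges p \<inter> edge_boundary E X = walk_edges p" by blast
  then show False using ear_cut_parity[OF ear, of X] assms(2) \<open>odd (card (walk_edges p))\<close> by auto
qed

lemma sum_card_edge_disjoint:
  assumes "finite P" "edge_disjoint P" "finite B"
  shows "(\<Sum>p\<in>P. card (walk_edges p \<inter> B)) \<le> card B"
proof -
  have "(\<Sum>p\<in>P. card (walk_edges p \<inter> B)) = card (\<Union>p\<in>P. walk_edges p \<inter> B)"
    using assms by (intro card_UN_disjoint[symmetric])
      (auto simp: edge_disjoint_def pairwise_def disjnt_def finite_walk_edges)
  also have "\<dots> \<le> card B" using assms(3) by (intro card_mono) auto
  finally show ?thesis .
qed

lemma card_odd_ears_le:
  assumes "finite P" "edge_disjoint P" "\<forall>p\<in>P. odd_ear V E U p"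
    and "finite E" "{} \<notin> E" "U \<subseteq> X" "X \<inter> C = {}"
    and "\<And>e. e \<in> E \<Longrightarrow> e \<subseteq> X \<or> e \<subseteq> C \<or> e \<in> edge_boundary E X"
  shows "2 * card P \<le> 2 * card (inner_edges E X) + card (edge_boundary E C)"
proof -
  have "2 * card P = (\<Sum>p\<in>P. 2)" by simp
  also have "\<dots> \<le> (\<Sum>p\<in>P. 2 * card (walk_edges p \<inter> inner_edges E X) + card (walk_edges p \<inter> edge_boundary E C))"
    using assms(3,5-8) by (intro sum_mono odd_ear_weight) auto
  also have "\<dots> = 2 * (\<Sum>p\<in>P. card (walk_edges p \<inter> inner_edges E X)) + (\<Sum>p\<in>P. card (walk_edges p \<inter> edge_boundary E C))"
    by (simp add: sum.distrib sum_distrib_left)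
  also have "\<dots> \<le> 2 * card (inner_edges E X) + card (edge_boundary E C)"
    using assms(1,2,4) by (intro add_mono mult_le_mono2 sum_card_edge_disjoint) (auto simp: inner_edges_def edge_boundary_def)
  finally show ?thesis .
qed

subsection \<open>Maximal barriers and the counting argument\<close>

text \<open>Deleting the only neighbour of \<open>x\<close> in \<open>A\<close> isolates
  \<open>x\<close> and leaves an odd rest. One deleted vertex thus yields two odd parts.\<close>

lemma odd_barrier_split:
  assumes edges: "\<And>e. e \<in> E \<Longrightarrow> card e = 2" and A: "finite A" "odd (card A)" "card A \<noteq> 1"
    and x: "x \<in> A" and deg: "\<And>y z. y \<in> A \<Longrightarrow> z \<in> A \<Longrightarrow> {x, y} \<in> E \<Longrightarrow> {x, z} \<in> E \<Longrightarrow> y = z"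
  obtains y where "y \<in> A" "odd_barrier E A {y} {{x}, A - {x, y}}" "{x} \<noteq> A - {x, y}"
proof -
  have "A - {x} \<noteq> {}"
    using A x by (metis card_1_singleton_iff Diff_eq_empty_iff One_nat_def insert_absorb singleton_insert_inj_eq' subset_insert_iff)
  moreover have "{x, x} \<notin> E" using edges by fastforce
  \<comment> \<open>If \<open>x\<close> has no neighbour in \<open>A\<close>, any other vertex of
    \<open>A\<close> serves as \<open>y\<close>.\<close>
  ultimately obtain y where y: "y \<in> A" "y \<noteq> x" and nb: "\<And>z. z \<in> A \<Longrightarrow> {x, z} \<in> E \<Longrightarrow> z = y"
    using deg by (cases "\<exists>y\<in>A. {x, y} \<in> E") blast+
  have "card {x, y} = 2" using y by simp
  moreover have "card A = card {x, y} + card (A - {x, y})"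
    using A x y by (metis card_Diff_subset card_mono empty_subsetI finite.emptyI finite.insertI insert_subset le_add_diff_inverse)
  ultimately have o: "odd (card (A - {x, y}))" using A by presburger
  have sep: "separated E {x} (A - {x, y})"
    unfolding separated_def
  proof (intro conjI ballI)
    fix e assume e: "e \<in> E"
    show "disjnt e {x} \<or> disjnt e (A - {x, y})"
    proof (rule ccontr)
      assume "\<not> ?thesis"
      then obtain z where z: "x \<in> e" "z \<in> e" "z \<in> A - {x, y}" by (auto simp: disjnt_def)
      then have "e = {x, z}" using edges[OF e] by (auto simp: card_2_iff)
      then show False using nb[of z] z e by auto
    qed
  qed simp
  then have "odd_barrier E A {y} {{x}, A - {x, y}}"
    using o x y separated_sym by (auto simp: odd_barrier_def pairwise_separated_insert)
  moreover have "{x} \<noteq> A - {x, y}" by blast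
  ultimately show ?thesis by (rule that[OF y(1)])
qed

text \<open>Among barriers with \<open>card S < card \<C>\<close> take one with the most parts. A
  non-singleton part without a cycle has a vertex with at most one neighbour in it; splitting there
  raises \<open>card S\<close> and \<open>card \<C>\<close> by one each, contradicting
  maximality.\<close>

lemma tutte_maximal:
  assumes "finite W" "even (card W)" and edges: "\<And>e. e \<in> E \<Longrightarrow> card e = 2"
    and "\<nexists>N. perfect_matching W E N"
  obtains S \<C> where "odd_barrier E W S \<C>" "card \<C> \<ge> card S + 2"
    "\<And>A. A \<in> \<C> \<Longrightarrow> card A = 1 \<or> (\<exists>c. is_cycle A E c)"
proof -
  define good where "good k \<longleftrightarrow> (\<exists>S \<C>. odd_barrier E W S \<C> \<and> card S < card \<C> \<and> card \<C> = k)" for k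
  have "\<exists>S \<C>. odd_barrier E W S \<C> \<and> card S < card \<C>"
  proof (rule ccontr)
    assume "\<not> ?thesis"
    then have "card \<C> \<le> card S" if "odd_barrier E W S \<C>" for S \<C>
      using that not_less by blast
    from tutte[OF assms(1,2) edges this] show False using assms(4) by blast
  qed
  then obtain k0 where "good k0" unfolding good_def by blast
  moreover have "\<forall>k. good k \<longrightarrow> k \<le> card (Pow W)"
    using assms(1) by (auto simp: good_def odd_barrier_def simp del: card_Pow intro!: card_mono)
  ultimately obtain k where "good k" and kmax: "\<And>j. good j \<Longrightarrow> j \<le> k"
    by (metis Nat.ex_has_greatest_nat)
  then obtain S \<C> where b: "odd_barrier E W S \<C>" and lt: "card S < card \<C>" and k: "card \<C> = k"
    unfolding good_def by blast
  have ge: "card \<C> \<ge> card S + 2"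
    using odd_barrier_parity[OF b assms(1)] assms(2) lt by presburger
  have "card A = 1 \<or> (\<exists>c. is_cycle A E c)" if A: "A \<in> \<C>" for A
  proof (rule ccontr)
    assume neg: "\<not> ?thesis"
    have fA: "finite A" using odd_barrier_finite(3)[OF b assms(1) A] .
    have oA: "odd (card A)" using b A by (auto simp: odd_barrier_def)
    then have "A \<noteq> {}" by auto
    have "\<not> (\<forall>x\<in>A. \<exists>y\<in>A. \<exists>z\<in>A. y \<noteq> z \<and> {x, y} \<in> E \<and> {x, z} \<in> E)"
      using min_degree_imp_cycle[OF fA \<open>A \<noteq> {}\<close> edges] neg by blast
    then obtain x where x: "x \<in> A"
      and deg: "\<And>y z. y \<in> A \<Longrightarrow> z \<in> A \<Longrightarrow> {x, y} \<in> E \<Longrightarrow> {x, z} \<in> E \<Longrightarrow> y = z"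
      by blast
    have "card A \<noteq> 1" using neg by simp
    from odd_barrier_split[OF edges fA oA this x deg]
    obtain y where y: "odd_barrier E A {y} {{x}, A - {x, y}}" "{x} \<noteq> A - {x, y}" .
    note r = odd_barrier_refine[OF assms(1) b A y(1)]
    have "card (\<C> - {A} \<union> {{x}, A - {x, y}}) = card \<C> + 1" using r(3) y(2) by simp
    moreover from this have "good (card \<C> + 1)"
      unfolding good_def using r(1,2) lt
      by (intro exI[of _ "S \<union> {y}"] exI[of _ "\<C> - {A} \<union> {{x}, A - {x, y}}"]) simp
    from kmax[OF this] k show False by simp
  qed
  with that b ge show ?thesis by blast
qed

section \<open>Edges leaving the parts\<close>

lemma cyclic_cut_ge:
  assumes "simple_graph V E" "cyclic_edge_connectivity V E \<ge> enat k"
    and "A \<subseteq> V" "B \<subseteq> V" "A \<inter> B = {}" "is_cycle A E c" "is_cycle B E d"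
  shows "k \<le> card (edge_boundary E A)"
proof -
  have "is_cycle (V - A) E d" using assms(4,5,7) unfolding is_cycle_def by blast
  then have "cyclic_edge_cut V E (edge_boundary E A)"
    using cut_is_cyclic_edge_cut[OF assms(1,3,6)] by blast
  then have "cyclic_edge_connectivity V E \<le> enat (card (edge_boundary E A))"
    unfolding cyclic_edge_connectivity_def by (intro Inf_lower) blast
  then show ?thesis using assms(2) by (metis enat_ord_simps(1) order_trans)
qed

text \<open>An edge leaving a part ends outside all parts, so the boundaries of the parts are
  disjoint and lie in the boundary of the complement.\<close>

lemma sum_cut_le:
  assumes "simple_graph V E" "pairwise (separated E) \<C>" "\<Union>\<C> \<subseteq> V"
  shows "(\<Sum>A\<in>\<C>. card (edge_boundary E A)) \<le> card (edge_boundary E (V - \<Union>\<C>))"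
proof -
  have finV: "finite V" "finite E" using simple_graph_finite[OF assms(1)] by auto
  then have fin: "finite \<C>" using assms(3) by (meson finite_UnionD finite_subset)
  have edge: "\<exists>a b. e = {a, b} \<and> a \<noteq> b \<and> a \<in> A \<and> a \<in> V \<and> b \<in> V \<and> b \<notin> \<Union>\<C>"
    if e: "e \<in> edge_boundary E A" and A: "A \<in> \<C>" for e A
  proof -
    obtain u v where uv: "e = {u, v}" "u \<noteq> v" "u \<in> V" "v \<in> V"
      using e assms(1) by (auto simp: edge_boundary_def simple_graph_def card_2_iff)
    obtain a b where ab: "e = {a, b}" "a \<noteq> b" "a \<in> V" "b \<in> V" "a \<in> A" "b \<notin> A"
      using uv e pair_in_edge_boundary_iff[OF uv(2), of E A] by (metis insert_commute)
    have "b \<notin> B" if "B \<in> \<C>" for B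
    proof
      assume "b \<in> B"
      then have "B \<noteq> A" using ab by auto
      then have "separated E A B" using assms(2) A that by (auto simp: pairwise_def)
      then show False using \<open>b \<in> B\<close> ab e by (auto simp: separated_def edge_boundary_def)
    qed
    then show ?thesis using ab by blast
  qed
  have "(\<Sum>A\<in>\<C>. card (edge_boundary E A)) = card (\<Union>A\<in>\<C>. edge_boundary E A)"
  proof (rule card_UN_disjoint[symmetric])
    show "\<forall>A\<in>\<C>. \<forall>B\<in>\<C>. A \<noteq> B \<longrightarrow> edge_boundary E A \<inter> edge_boundary E B = {}"
    proof (intro ballI impI equals0I, elim IntE)
      fix A B e assume "A \<in> \<C>" "B \<in> \<C>" "A \<noteq> B" and e: "e \<in> edge_boundary E A" "e \<in> edge_boundary E B"
      then have "separated E A B" using assms(2) by (auto simp: pairwise_def)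
      then have "e \<inter> A = {} \<or> e \<inter> B = {}" using e by (auto simp: separated_def edge_boundary_def disjnt_def)
      then show False using e by (auto simp: edge_boundary_def)
    qed
  qed (use fin finV in \<open>auto simp: edge_boundary_def\<close>)
  also have "\<dots> \<le> card (edge_boundary E (V - \<Union>\<C>))"
  proof (rule card_mono)
    show "(\<Union>A\<in>\<C>. edge_boundary E A) \<subseteq> edge_boundary E (V - \<Union>\<C>)"
    proof
      fix e assume "e \<in> (\<Union>A\<in>\<C>. edge_boundary E A)"
      then obtain A where A: "A \<in> \<C>" "e \<in> edge_boundary E A" by blast
      obtain a b where ab: "e = {a, b}" "a \<noteq> b" "a \<in> A" "a \<in> V" "b \<in> V" "b \<notin> \<Union>\<C>"
        using edge[OF A(2,1)] by blast
      then show "e \<in> edge_boundary E (V - \<Union>\<C>)" using A pair_in_edge_boundary_iff[OF ab(2)] by (auto simp: edge_boundary_def)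
    qed
  qed (use finV in \<open>auto simp: edge_boundary_def\<close>)
  finally show ?thesis .
qed

lemma card_cut_singleton:
  assumes "simple_graph V E" "v \<in> V"
  shows "card (edge_boundary E {v}) = degree E v"
proof -
  have "edge_boundary E {v} = {e \<in> E. v \<in> e}" by (auto simp: edge_boundary_def Int_insert_right)
  then show ?thesis by (simp add: degree_def)
qed

section \<open>Counting degrees against odd ears\<close>

theorem theorem4:
  fixes m r :: nat and V :: "'a set" and E M :: "'a set set"
  assumes "m \<ge> r" and "r \<ge> 3"
    and "simple_graph V E" and "regular r V E" and "even (card V)"
    and "cyclic_edge_connectivity V E \<ge> enat (m * r - m + 1)"
    and "distance_matching 3 V E M" and "card M = m"
    and "\<exists>P. finite P \<and> int (card P) = int m * int r - \<lceil>real r / 2\<rceil> + 1 \<and>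
           edge_disjoint P \<and> (\<forall>p\<in>P. odd_ear V E (\<Union>M) p)"
  shows "extends_to_perfect_matching V E M"
proof (rule ccontr)
  assume not_ext: "\<not> ?thesis"
  obtain P where P: "finite P" "int (card P) = int m * int r - \<lceil>real r / 2\<rceil> + 1"
    "edge_disjoint P" "\<forall>p\<in>P. odd_ear V E (\<Union>M) p" using assms(9) by blast
  define U where "U = \<Union>M"
  define W where "W = V - U"
  have edges: "e \<subseteq> V" "card e = 2" if "e \<in> E" for e
    using assms(3) that by (auto simp: simple_graph_def)
  have M: "M \<subseteq> E" "pairwise disjnt M"
    using assms(7) by (auto simp: distance_matching_def matching_def)
  have fin: "finite V" "finite E" using simple_graph_finite[OF assms(3)] by auto
  have UV: "U \<subseteq> V" using M edges by (auto simp: U_def)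
  have "card U = (\<Sum>e\<in>M. card e)"
    unfolding U_def using M edges fin by (intro card_Union_disjoint) (auto intro: finite_subset)
  also have "\<dots> = (\<Sum>e\<in>M. 2)" using M edges by (intro sum.cong) auto
  finally have cardU: "card U = 2 * m" using assms(8) by simp
  have "\<nexists>N. perfect_matching W E N"
  proof
    assume "\<exists>N. perfect_matching W E N"
    then obtain N where N: "N \<subseteq> E" "pairwise disjnt N" "\<Union>N = V - \<Union>M"
      by (auto simp: perfect_matching_def matching_def W_def U_def)
    have "disjnt e f" if "e \<in> M" "f \<in> N" for e f
      using N(3) that by (fastforce simp: disjnt_def)
    then have "pairwise disjnt (M \<union> N)"
      using M(2) N(2) unfolding pairwise_def by (metis UnE disjnt_sym)
    moreover have "\<Union>(M \<union> N) = V" using N(3) UV by (auto simp: U_def)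
    ultimately have "perfect_matching V E (M \<union> N)"
      using M N by (simp add: perfect_matching_def matching_def)
    then show False using not_ext by (auto simp: extends_to_perfect_matching_def)
  qed
  moreover have "even (card W)"
    using assms(5) cardU UV fin by (simp add: W_def card_Diff_subset finite_subset)
  ultimately obtain S \<C> where b: "odd_barrier E W S \<C>" and ge: "card \<C> \<ge> card S + 2"
    and cyc: "\<And>A. A \<in> \<C> \<Longrightarrow> card A = 1 \<or> (\<exists>c. is_cycle A E c)"
    using tutte_maximal[of W E] edges fin by (metis W_def finite_Diff)
  have finW: "finite W" using fin by (simp add: W_def)
  have sep: "pairwise (separated E) \<C>" and un: "\<Union>\<C> = W - S" and SW: "S \<subseteq> W"
    using b by (auto simp: odd_barrier_def)
  have CV: "A \<subseteq> V" if "A \<in> \<C>" for A using un that by (auto simp: W_def)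
  have finC: "finite \<C>" and finS: "finite S" using odd_barrier_finite[OF b finW] by auto
  define X where "X = V - \<Union>\<C>"
  have X: "X = S \<union> U" using un SW UV by (auto simp: X_def W_def)
  have "card X = card S + 2 * m"
    unfolding X using finS finite_subset[OF UV fin(1)] SW cardU
    by (subst card_Un_disjoint) (auto simp: W_def)
  moreover have "(\<Sum>v\<in>X. degree E v) = (\<Sum>v\<in>X. r)"
    using assms(4) by (intro sum.cong) (auto simp: regular_def X_def)
  moreover have "X \<subseteq> V" by (auto simp: X_def)
  ultimately have degX: "r * (card S + 2 * m) = 2 * card (inner_edges E X) + card (edge_boundary E X)"
    using sum_degree[OF assms(3), of X] by (simp add: mult.commute)
  have cutX: "(\<Sum>A\<in>\<C>. card (edge_boundary E A)) \<le> card (edge_boundary E X)"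
    unfolding X_def using un by (intro sum_cut_le assms(3) sep) (auto simp: W_def)
  have single: "card (edge_boundary E A) = r" if "A \<in> \<C>" "card A = 1" for A
    using that card_cut_singleton[OF assms(3)] assms(4) CV[OF that(1)]
    by (auto simp: card_1_singleton_iff regular_def)
  \<comment> \<open>These are the parts that must contain a cycle; two of them would make each
    boundary a cyclic edge cut.\<close>
  define Q where "Q = {A \<in> \<C>. card A \<noteq> 1}"
  have Q1: "A = B" if AB: "A \<in> Q" "B \<in> Q" for A B
  proof (rule ccontr)
    assume "A \<noteq> B"
    have big: "m * r - m + 1 \<le> card (edge_boundary E D)" if D: "D \<in> Q" for D
    proof -
      obtain D' where D': "D' \<in> Q" "D' \<noteq> D" using AB \<open>A \<noteq> B\<close> by metis
      have "separated E D D'" using sep D D' by (auto simp: Q_def pairwise_def)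
      then have disj: "D \<inter> D' = {}" by (rule separated_disjoint)
      have "D \<in> \<C>" "D' \<in> \<C>" using D D' by (auto simp: Q_def)
      moreover obtain c d where "is_cycle D E c" "is_cycle D' E d"
        using cyc[of D] cyc[of D'] D D' by (auto simp: Q_def)
      ultimately show ?thesis using cyclic_cut_ge[OF assms(3,6) _ _ disj] CV by blast
    qed
    \<comment> \<open>So the larger bound also gives at least \<open>r\<close>, and every part sends
      out at least \<open>r\<close> edges.\<close>
    have "r \<le> m * r - m + 1"
    proof -
      have "m * r - m = m * (r - 1)" by (simp add: diff_mult_distrib2)
      moreover have "r * 1 \<le> m * (r - 1)" using assms(1,2) by (intro mult_le_mono) auto
      ultimately show ?thesis by simp
    qed
    then have small: "r \<le> card (edge_boundary E D)" if "D \<in> \<C>" for D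
      using single[OF that] big[of D] that by (cases "card D = 1") (auto simp: Q_def)
    have AC: "A \<in> \<C>" "B \<in> \<C> - {A}" using AB \<open>A \<noteq> B\<close> by (auto simp: Q_def)
    have "card (\<C> - {A} - {B}) \<ge> card S" using AC finC ge by simp
    then have "r * card S \<le> (\<Sum>D\<in>\<C> - {A} - {B}. r)" by simp
    also have "\<dots> \<le> (\<Sum>D\<in>\<C> - {A} - {B}. card (edge_boundary E D))" by (intro sum_mono small) auto
    also have "card (edge_boundary E A) + (card (edge_boundary E B) + \<dots>) = (\<Sum>D\<in>\<C>. card (edge_boundary E D))"
      using AC finC by (simp add: sum.remove[of \<C> A] sum.remove[of "\<C> - {A}" B])
    finally have "card (edge_boundary E A) + card (edge_boundary E B) + r * card S \<le> (\<Sum>D\<in>\<C>. card (edge_boundary E D))"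
      by linarith
    \<comment> \<open>The edges of \<open>M\<close> lie inside \<open>X\<close> and absorb
      \<open>2 * m\<close> of its degree sum. At most \<open>r * card S + 2 * (m * r - m)\<close>
      edges leave \<open>X\<close>, two fewer than the parts demand.\<close>
    moreover have "m \<le> card (inner_edges E X)"
      unfolding assms(8)[symmetric] using fin M(1) by (intro card_mono) (auto simp: inner_edges_def X U_def)
    moreover have "m \<le> m * r" using assms(2) by simp
    moreover have "r * (card S + 2 * m) = r * card S + 2 * (m * r)" by (simp add: algebra_simps)
    ultimately show False using degX cutX big[OF AB(1)] big[OF AB(2)] by linarith
  qed
  have "\<C> \<noteq> {}" using ge by auto
  \<comment> \<open>\<open>C\<close> is the part with a cycle if there is one, and otherwise an
    arbitrary part.\<close>
  then obtain C where C: "C \<in> \<C>" "\<And>A. A \<in> \<C> - {C} \<Longrightarrow> card A = 1"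
    using Q1 unfolding Q_def by (cases "\<forall>A\<in>\<C>. card A = 1") blast+
  have "card S + 1 \<le> card (\<C> - {C})" using ge C(1) finC by simp
  then have "r * (card S + 1) \<le> (\<Sum>A\<in>\<C> - {C}. r)"
    by (simp only: sum_constant of_nat_id mult.commute[of _ r] mult_le_mono2)
  also have "\<dots> = (\<Sum>A\<in>\<C> - {C}. card (edge_boundary E A))" using single C by (intro sum.cong) auto
  also have "card (edge_boundary E C) + \<dots> = (\<Sum>A\<in>\<C>. card (edge_boundary E A))"
    using C(1) finC by (simp add: sum.remove)
  finally have cutC: "card (edge_boundary E C) + r * (card S + 1) \<le> card (edge_boundary E X)" using cutX by linarith
  have "2 * card P \<le> 2 * card (inner_edges E X) + card (edge_boundary E C)"
  proof (rule card_odd_ears_le)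
    show "\<forall>p\<in>P. odd_ear V E U p" using P(4) by (simp add: U_def)
    show "U \<subseteq> X" "X \<inter> C = {}" using X C(1) by (auto simp: X_def)
    show "{} \<notin> E" using edges by fastforce
    fix e assume e: "e \<in> E"
    then obtain u v where uv: "e = {u, v}" "u \<noteq> v" "u \<in> V" "v \<in> V"
      using edges[OF e] by (auto simp: card_2_iff)
    \<comment> \<open>An edge missing \<open>X\<close> lies within one part; a singleton holds no
      edge, so that part is \<open>C\<close>.\<close>
    show "e \<subseteq> X \<or> e \<subseteq> C \<or> e \<in> edge_boundary E X"
    proof (cases "u \<notin> X \<and> v \<notin> X")
      case True
      then obtain A B where AB: "A \<in> \<C>" "B \<in> \<C>" "u \<in> A" "v \<in> B" using uv by (auto simp: X_def)
      have "\<not> separated E A B" using AB(3,4) e unfolding uv(1) separated_def by fastforce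
      then have "A = B" using sep AB by (auto simp: pairwise_def)
      then have "card A \<noteq> 1" using AB uv by (auto simp: card_1_singleton_iff)
      then have "A = C" using C AB by blast
      then show ?thesis using AB \<open>A = B\<close> uv by auto
    next
      case False
      then show ?thesis using uv e pair_in_edge_boundary_iff[OF uv(2), of E X] by auto
    qed
  qed (use P fin in auto)
  \<comment> \<open>The inner edges of \<open>X\<close> and the boundary of \<open>C\<close> are
    eliminated together; the terms \<open>r * card S\<close> then cancel.\<close>
  then have "2 * card P + r * (card S + 1) \<le> r * (card S + 2 * m)"
    using cutC degX by linarith
  then have "2 * card P + r \<le> 2 * (m * r)" by (simp add: algebra_simps)
  then have "2 * int (card P) + int r \<le> 2 * (int m * int r)"
    by (metis of_nat_add of_nat_le_iff of_nat_mult of_nat_numeral)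
  \<comment> \<open>With the assumed number of ears this gives
    \<open>2 * card P \<ge> 2 * m * r - r + 1\<close>, exceeding the bound by one.\<close>
  moreover have "2 * \<lceil>real r / 2\<rceil> \<le> int r + 1" by linarith
  ultimately show False using P(2) by linarith
qed

end
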